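(* Let $K\ge 2$ be an integer and let $\alpha,\beta>0$ be constants with $\sqrt{\alpha}-\sqrt{\beta}>\sqrt{K}$. Let $\bm{A}$ be the adjacency matrix of a realization of the random graph generated according to the symmetric SBM with parameters $(n,K,p,q)$ and a planted partition $\bm{H}^*\in\mathbb{H}_{n,K}$, where $p=\alpha\log n/n$, $q=\beta\log n/n$, and $n$ is sufficiently large. Let $c_1,\gamma>0$ be the constants described in the context, let $$\phi=\frac{c_1\sqrt{K}}{16(\alpha-\beta)},\qquad \theta=\frac14\min\left\{\frac{1}{\sqrt{K}},\frac{\gamma\sqrt{K}}{16(\alpha-\beta)}\right\},$$ and suppose that $$n>\exp\left(\max\left\{\frac{64c_1^2}{\gamma^2},\frac{\gamma^2}{c_1^2},\frac{4\sqrt{2}\phi}{\sqrt{\gamma}},\frac{256c_1^4}{\gamma^4}\right\}\right).$$ Then the following statement holds with probability at least $1-n^{-\Omega(1)}$: if the initial point $\bm{H}^0\in\mathbb{M}_{n,K}$ satisfies $$\|\bm{H}^0-\bm{H}^*\bm{Q}\|_F\le\theta\sqrt{n}$$ for some $\bm{Q}\in\Pi_K$, then the projected power method outputs $\bm{H}^*\bm{Q}$ within $$N_0=\lceil 2\log\log n\rceil+\left\lceil\frac{2\log n}{\log\log n}\right\rceil+2$$ projected power iterations; i.e., run with $N=N_0$, its output satisfies $\bm{H}^{N+1}=\bm{H}^*\bm{Q}$.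
   Context: Throughout, $n=mK$ with $m$ a positive integer, $\|\cdot\|_F$ is the Frobenius norm, $\|\cdot\|$ is the spectral norm, $[n]=\{1,\dots,n\}$, $\bm{1}_d$ is the all-one vector in $\mathbb{R}^d$, and $\Pi_K$ is the set of all $K\times K$ permutation matrices. Clustering matrices: $\bm{H}\in\mathbb{R}^{n\times K}$ is a clustering matrix if there are pairwise disjoint sets $\mathcal{I}_1,\dots,\mathcal{I}_K$ with $\bigcup_k\mathcal{I}_k=[n]$ such that $h_{ik}=1$ if $i\in\mathcal{I}_k$ and $h_{ik}=0$ otherwise; it is balanced if in addition $|\mathcal{I}_k|=m$ for all $k$. $\mathbb{M}_{n,K}$ and $\mathbb{H}_{n,K}$ denote the sets of all clustering matrices and of all balanced clustering matrices, respectively. Symmetric SBM with parameters $(n,K,p,q)$ and planted partition $\bm{H}^*\in\mathbb{H}_{n,K}$: a random graph on $[n]$ whose symmetric adjacency matrix $\bm{A}=(a_{ij})$ has independent entries $\{a_{ij}\}_{1\le i\le j\le n}$ (diagonal included), with $a_{ij}\sim\mathrm{Bernoulli}(p)$ if rows $i$ and $j$ of $\bm{H}^*$ are equal (same community) and $a_{ij}\sim\mathrm{Bernoulli}(q)$ otherwise. Projection: $\mathcal{H}=\{\bm{H}\in\{0,1\}^{n\times K}:\bm{H}\bm{1}_K=\bm{1}_n,\ \bm{H}^T\bm{1}_n=m\bm{1}_K\}$, and for $\bm{C}\in\mathbb{R}^{n\times K}$, $\mathcal{T}(\bm{C})=\operatorname{argmin}\{\|\bm{H}-\bm{C}\|_F:\bm{H}\in\mathcal{H}\}$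 (the set of all minimizers). Projected power method with input $\bm{A}$, a positive integer $N$ and an initial point $\bm{H}^0$: choose any $\bm{H}^1\in\mathcal{T}(\bm{H}^0)$; for $k=1,\dots,N$ choose any $\bm{H}^{k+1}\in\mathcal{T}(\bm{A}\bm{H}^k)$; output $\bm{H}^{N+1}$. Constants: $c_1>0$ is a constant depending only on $\alpha,\beta$ such that $\|\bm{A}-\mathbb{E}[\bm{A}]\|\le c_1\sqrt{\log n}$ holds with probability at least $1-n^{-3}$. $\gamma>0$ is a constant depending only on $\alpha,\beta,K$ such that, with $\mathcal{I}_k=\{i\in[n]:h^*_{ik}=1\}$ and $\bm{C}=\bm{A}\bm{H}^*$, with probability at least $1-n^{-\Omega(1)}$ one has $c_{ik}-c_{i\ell}\ge\gamma\log n$ for all $i\in\mathcal{I}_k$ and $1\le k\ne\ell\le K$. (Such constants exist.) "With probability at least $1-n^{-\Omega(1)}$" means: with probability at least $1-n^{-c}$ for a constant $c>0$ depending only on $\alpha,\beta,K$, for all $n$ larger than a constant depending only on $\alpha,\beta,K$. *)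

theory Defs
  imports "HOL-Probability.Product_PMF" "Jordan_Normal_Form.Matrix"
begin

text \<open>
  Matrices have varying dimensions, so they are modelled by the type \<open>real mat\<close> with explicit
  carriers; rows and columns are indexed from \<open>0\<close>, so that \<open>[n]\<close> becomes \<open>{..<n}\<close>.
  Constants such as \<open>mat\<close>, \<open>vec\<close> and \<open>row\<close> are qualified because the fixed-dimension
  vectors of the analysis library use the same names.
\<close>

unbundle no vec_syntax
no_notation Inner_Product.real_inner_class.inner (infix "\<bullet>" 70)

definition euclid_norm :: "real Matrix.vec \<Rightarrow> real" where
  "euclid_norm v = sqrt (v \<bullet> v)"

definition frobenius_norm :: "real mat \<Rightarrow> real" where
  "frobenius_norm X = sqrt (\<Sum>i<dim_row X. \<Sum>j<dim_col X. (X $$ (i, j))\<^sup>2)"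

text \<open>The spectral norm is the operator norm induced by the Euclidean norms; the supremum ranges
  over a nonempty bounded set as soon as the matrix has at least one column.\<close>

definition spectral_norm :: "real mat \<Rightarrow> real" where
  "spectral_norm X =
     Sup {euclid_norm (X *\<^sub>v v) | v. v \<in> carrier_vec (dim_col X) \<and> euclid_norm v = 1}"

definition ones_vec :: "nat \<Rightarrow> real Matrix.vec" where
  "ones_vec d = Matrix.vec d (\<lambda>_. 1)"

definition permutation_mats :: "nat \<Rightarrow> real mat set" where
  "permutation_mats K =
     {Matrix.mat K K (\<lambda>(i, j). if j = \<pi> i then 1 else 0) | \<pi>. \<pi> permutes {..<K}}"

definition clustering_partition :: "nat \<Rightarrow> nat \<Rightarrow> (nat \<Rightarrow> nat set) \<Rightarrow> real mat \<Rightarrow> bool" where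
  "clustering_partition n K I H \<longleftrightarrow>
     H \<in> carrier_mat n K \<and> disjoint_family_on I {..<K} \<and> (\<Union>k<K. I k) = {..<n} \<and>
     (\<forall>i<n. \<forall>k<K. H $$ (i, k) = (if i \<in> I k then 1 else 0))"

definition clustering_mats :: "nat \<Rightarrow> nat \<Rightarrow> real mat set" where
  "clustering_mats n K = {H. \<exists>I. clustering_partition n K I H}"

text \<open>The balanced notions take the community size \<open>m\<close> as parameter; the number of rows is
  \<open>n = m * K\<close>.\<close>

definition balanced_clustering_mats :: "nat \<Rightarrow> nat \<Rightarrow> real mat set" where
  "balanced_clustering_mats m K =
     {H. \<exists>I. clustering_partition (m * K) K I H \<and> (\<forall>k<K. card (I k) = m)}"

definition feasible_mats :: "nat \<Rightarrow> nat \<Rightarrow> real mat set" where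
  "feasible_mats m K =
     {H \<in> carrier_mat (m * K) K. elements_mat H \<subseteq> {0, 1} \<and>
        H *\<^sub>v ones_vec K = ones_vec (m * K) \<and>
        transpose_mat H *\<^sub>v ones_vec (m * K) = real m \<cdot>\<^sub>v ones_vec K}"

definition projection :: "nat \<Rightarrow> nat \<Rightarrow> real mat \<Rightarrow> real mat set" where
  "projection m K C =
     {H. is_arg_min (\<lambda>H. frobenius_norm (H - C)) (\<lambda>H. H \<in> feasible_mats m K) H}"

text \<open>The projections are set-valued, so one input can have several runs; the following holds
  if some run of the projected power method with \<open>N\<close> iterations returns \<open>H\<close>.\<close>

definition ppm_output :: "nat \<Rightarrow> nat \<Rightarrow> real mat \<Rightarrow> nat \<Rightarrow> real mat \<Rightarrow> real mat \<Rightarrow> bool" where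
  "ppm_output m K A N H0 H \<longleftrightarrow>
     (\<exists>X. X 1 \<in> projection m K H0 \<and>
          (\<forall>k\<in>{1..N}. X (Suc k) \<in> projection m K (A * X k)) \<and>
          H = X (Suc N))"

text \<open>The law of the adjacency matrix: one independent Bernoulli variable for every pair
  \<open>i \<le> j\<close>, extended symmetrically.  The default value \<open>False\<close> outside the index set is never
  read.  Note that \<open>bernoulli_pmf\<close> truncates its parameter to the unit interval.\<close>

definition sbm :: "nat \<Rightarrow> real \<Rightarrow> real \<Rightarrow> real mat \<Rightarrow> real mat pmf" where
  "sbm n p q Hs =
     map_pmf (\<lambda>E. Matrix.mat n n (\<lambda>(i, j). of_bool (E (min i j, max i j))))
       (Pi_pmf {(i, j). i \<le> j \<and> j < n} False
          (\<lambda>(i, j). bernoulli_pmf (if Matrix.row Hs i = Matrix.row Hs j then p else q)))"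

definition log_sbm :: "real \<Rightarrow> real \<Rightarrow> nat \<Rightarrow> real mat \<Rightarrow> real mat pmf" where
  "log_sbm \<alpha> \<beta> n Hs = sbm n (\<alpha> * ln (real n) / real n) (\<beta> * ln (real n) / real n) Hs"

definition expected_mat :: "nat \<Rightarrow> real mat pmf \<Rightarrow> real mat" where
  "expected_mat n M = Matrix.mat n n (\<lambda>(i, j). measure_pmf.expectation M (\<lambda>A. A $$ (i, j)))"

text \<open>The two constants of the analysis.  Both bounds are required for all sufficiently large
  \<open>n\<close> only, uniformly in the planted partition.\<close>

definition concentration_const :: "real \<Rightarrow> real \<Rightarrow> nat \<Rightarrow> real \<Rightarrow> bool" where
  "concentration_const \<alpha> \<beta> K c1 \<longleftrightarrow> c1 > 0 \<and>
     (\<exists>n0::nat. \<forall>n m Hs. m > 0 \<and> n = m * K \<and> n \<ge> n0 \<and> Hs \<in> balanced_clustering_mats m K \<longrightarrow>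
        measure_pmf.prob (log_sbm \<alpha> \<beta> n Hs)
          {A. spectral_norm (A - expected_mat n (log_sbm \<alpha> \<beta> n Hs)) \<le> c1 * sqrt (ln (real n))}
        \<ge> 1 - real n powr (-3))"

definition separation_const :: "real \<Rightarrow> real \<Rightarrow> nat \<Rightarrow> real \<Rightarrow> bool" where
  "separation_const \<alpha> \<beta> K \<gamma> \<longleftrightarrow> \<gamma> > 0 \<and>
     (\<exists>c>0. \<exists>n0::nat. \<forall>n m Hs.
        m > 0 \<and> n = m * K \<and> n \<ge> n0 \<and> Hs \<in> balanced_clustering_mats m K \<longrightarrow>
        measure_pmf.prob (log_sbm \<alpha> \<beta> n Hs)
          {A. \<forall>k<K. \<forall>l<K. k \<noteq> l \<longrightarrow> (\<forall>i<n. Hs $$ (i, k) = 1 \<longrightarrow>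
                (A * Hs) $$ (i, k) - (A * Hs) $$ (i, l) \<ge> \<gamma> * ln (real n))}
        \<ge> 1 - real n powr (-c))"

definition iteration_bound :: "nat \<Rightarrow> nat" where
  "iteration_bound n =
     nat \<lceil>2 * ln (ln (real n))\<rceil> + nat \<lceil>2 * ln (real n) / ln (ln (real n))\<rceil> + 2"

end

theory Submission
  imports Defs
begin

text \<open>
  Write \<open>L = ln n\<close>, let \<open>G = H\<^sup>* Q\<close> and let \<open>H\<close> be balanced with \<open>D\<close> rows different from those
  of \<open>G\<close>, so that \<open>\<parallel>H - G\<parallel>\<^sup>2 = 2 D\<close> in the Frobenius norm.  Split
  \<open>A H = A G + (A - E A) (H - G) + E A (H - G)\<close>.  In every row the first summand prefers the correct
  label by a margin of at least \<open>\<gamma> L\<close>.  Since \<open>G\<close> and \<open>H\<close> are balanced, the constant part of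
  \<open>E A\<close> cancels, and the third summand lowers the margin by at most \<open>(\<alpha> - \<beta>) L D / n \<le> \<gamma> L / 10\<close>.
  The second summand has Frobenius norm at most \<open>c1 sqrt (2 L D)\<close>.  The projection maximises an
  inner product, so the noise must pay for every wrong row of the new iterate; by Cauchy-Schwarz
  the number of wrong rows shrinks by the factor \<open>5 c1\<^sup>2 / (\<gamma>\<^sup>2 L) \<le> 1 / sqrt L\<close>.  After
  \<open>2 L / ln L\<close> iterations it has dropped from at most \<open>2 \<theta>\<^sup>2 n\<close> to at most \<open>2 \<theta>\<^sup>2 < 1\<close>, hence
  to zero.
\<close>

definition label_mat :: "nat \<Rightarrow> nat \<Rightarrow> (nat \<Rightarrow> nat) \<Rightarrow> real mat" where
  "label_mat n K s = Matrix.mat n K (\<lambda>(i, k). of_bool (s i = k))"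

definition balanced_labelling :: "nat \<Rightarrow> nat \<Rightarrow> (nat \<Rightarrow> nat) \<Rightarrow> bool" where
  "balanced_labelling m K s \<longleftrightarrow>
     (\<forall>i<m * K. s i < K) \<and> (\<forall>k<K. card {i. i < m * K \<and> s i = k} = m)"

definition mislabelled :: "nat \<Rightarrow> (nat \<Rightarrow> nat) \<Rightarrow> (nat \<Rightarrow> nat) \<Rightarrow> nat" where
  "mislabelled n s g = card {i. i < n \<and> s i \<noteq> g i}"

lemma label_mat_carrier [simp]: "label_mat n K s \<in> carrier_mat n K"
  by (simp add: label_mat_def)

lemma label_mat_dim [simp]:
  "dim_row (label_mat n K s) = n" "dim_col (label_mat n K s) = K"
  by (simp_all add: label_mat_def)

lemma label_mat_index [simp]:
  "i < n \<Longrightarrow> k < K \<Longrightarrow> label_mat n K s $$ (i, k) = of_bool (s i = k)"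
  by (simp add: label_mat_def)

lemma label_mat_cong:
  "(\<And>i. i < n \<Longrightarrow> s i = t i) \<Longrightarrow> label_mat n K s = label_mat n K t"
  by (auto simp: label_mat_def)

lemma sum_of_bool_card:
  "(\<Sum>i<(n::nat). of_bool (P i) :: real) = real (card {i. i < n \<and> P i})"
  by (simp add: Int_def)

lemma balanced_labellingD:
  assumes "balanced_labelling m K s"
  shows "\<And>i. i < m * K \<Longrightarrow> s i < K"
    and "\<And>k. k < K \<Longrightarrow> card {i. i < m * K \<and> s i = k} = m"
    and "\<And>k. k < K \<Longrightarrow> (\<Sum>i<m * K. of_bool (s i = k) :: real) = real m"
  using assms by (auto simp: balanced_labelling_def sum_of_bool_card)

lemma balanced_clustering_matsE:
  assumes "H \<in> balanced_clustering_mats m K"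
  obtains s where "balanced_labelling m K s" "H = label_mat (m * K) K s"
proof -
  let ?n = "m * K"
  from assms obtain I where I: "clustering_partition ?n K I H" and card: "\<And>k. k < K \<Longrightarrow> card (I k) = m"
    by (auto simp: balanced_clustering_mats_def)
  from I have car: "H \<in> carrier_mat ?n K" and dis: "disjoint_family_on I {..<K}"
    and un: "(\<Union>k<K. I k) = {..<?n}"
    and val: "\<And>i k. i < ?n \<Longrightarrow> k < K \<Longrightarrow> H $$ (i, k) = (if i \<in> I k then 1 else 0)"
    by (auto simp: clustering_partition_def)
  define s where "s i = (SOME k. k < K \<and> i \<in> I k)" for i
  have s: "s i < K \<and> i \<in> I (s i)" if "i < ?n" for i
    unfolding s_def by (rule someI_ex) (use un that in blast)
  have iff: "i \<in> I k \<longleftrightarrow> s i = k" if "i < ?n" "k < K" for i k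
    using s[OF that(1)] that dis by (auto simp: disjoint_family_on_def)
  have "{i. i < ?n \<and> s i = k} = I k" if "k < K" for k
    using un iff that by blast
  then have "balanced_labelling m K s"
    using s card by (auto simp: balanced_labelling_def)
  moreover have "H = label_mat ?n K s"
    using car val iff by (intro eq_matI) (auto simp: label_mat_def)
  ultimately show ?thesis using that by blast
qed

lemma feasible_mats_iff:
  "H \<in> feasible_mats m K \<longleftrightarrow> (\<exists>s. balanced_labelling m K s \<and> H = label_mat (m * K) K s)"
proof
  let ?n = "m * K"
  assume H: "H \<in> feasible_mats m K"
  then have car: "H \<in> carrier_mat ?n K" and el: "elements_mat H \<subseteq> {0, 1}"
    and r: "H *\<^sub>v ones_vec K = ones_vec ?n"
    and c: "transpose_mat H *\<^sub>v ones_vec ?n = real m \<cdot>\<^sub>v ones_vec K"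
    by (auto simp: feasible_mats_def)
  have val: "H $$ (i, k) = of_bool (H $$ (i, k) = 1)" if "i < ?n" "k < K" for i k
    using el elements_matI[OF car that refl] by auto
  have row: "(\<Sum>k<K. H $$ (i, k)) = 1" if "i < ?n" for i
    using arg_cong[OF r, of "\<lambda>v. v $ i"] that car
    by (simp add: ones_vec_def scalar_prod_def atLeast0LessThan)
  have col: "(\<Sum>i<?n. H $$ (i, k)) = real m" if "k < K" for k
    using arg_cong[OF c, of "\<lambda>v. v $ k"] that car
    by (simp add: ones_vec_def scalar_prod_def atLeast0LessThan)
  have uniq: "\<exists>!k. k < K \<and> H $$ (i, k) = 1" if i: "i < ?n" for i
  proof -
    have "(\<Sum>k<K. H $$ (i, k)) = (\<Sum>k<K. of_bool (H $$ (i, k) = 1))"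
      using val i by (intro sum.cong) auto
    then have "card {k. k < K \<and> H $$ (i, k) = 1} = 1"
      using row[OF i] by (simp add: sum_of_bool_card)
    then obtain k where "{k. k < K \<and> H $$ (i, k) = 1} = {k}"
      by (auto simp: card_1_singleton_iff)
    then show ?thesis by (intro ex1I[of _ k]) auto
  qed
  define s where "s i = (THE k. k < K \<and> H $$ (i, k) = 1)" for i
  have s: "s i < K \<and> H $$ (i, s i) = 1" if "i < ?n" for i
    unfolding s_def by (rule theI') (rule uniq[OF that])
  have iff: "H $$ (i, k) = 1 \<longleftrightarrow> s i = k" if "i < ?n" "k < K" for i k
    using s uniq that by blast
  have val': "H $$ (i, k) = of_bool (s i = k)" if "i < ?n" "k < K" for i k
    using val[OF that] iff[OF that] by simp
  have "real (card {i. i < ?n \<and> s i = k}) = real m" if "k < K" for k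
    using col[OF that] val' that by (simp flip: sum_of_bool_card)
  then have "balanced_labelling m K s"
    using s by (auto simp: balanced_labelling_def)
  moreover have "H = label_mat ?n K s"
    using car val' by (intro eq_matI) auto
  ultimately show "\<exists>s. balanced_labelling m K s \<and> H = label_mat ?n K s" by blast
next
  let ?n = "m * K"
  assume "\<exists>s. balanced_labelling m K s \<and> H = label_mat ?n K s"
  then obtain s where s: "balanced_labelling m K s" and H: "H = label_mat ?n K s" by blast
  have "elements_mat H \<subseteq> {0, 1}"
    by (auto simp: H dest!: elements_matD)
  moreover have "H *\<^sub>v ones_vec K = ones_vec ?n"
    using balanced_labellingD(1)[OF s]
    by (intro eq_vecI) (auto simp: H ones_vec_def scalar_prod_def atLeast0LessThan of_bool_def)
  moreover have "transpose_mat H *\<^sub>v ones_vec ?n = real m \<cdot>\<^sub>v ones_vec K"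
    using balanced_labellingD(3)[OF s]
    by (intro eq_vecI) (auto simp: H ones_vec_def scalar_prod_def atLeast0LessThan)
  ultimately show "H \<in> feasible_mats m K"
    by (simp add: feasible_mats_def H)
qed

lemma frobenius_norm_sq:
  "(frobenius_norm X)\<^sup>2 = (\<Sum>i<dim_row X. \<Sum>j<dim_col X. (X $$ (i, j))\<^sup>2)"
  by (simp add: frobenius_norm_def sum_nonneg)

lemma frobenius_norm_nonneg [simp]: "frobenius_norm X \<ge> 0"
  by (simp add: frobenius_norm_def sum_nonneg)

lemma frobenius_norm_triangle:
  assumes "X \<in> carrier_mat n K" "Y \<in> carrier_mat n K"
  shows "frobenius_norm (X + Y) \<le> frobenius_norm X + frobenius_norm Y"
proof -
  have *: "frobenius_norm Z = L2_set (\<lambda>(i, j). Z $$ (i, j)) ({..<n} \<times> {..<K})"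
    if "Z \<in> carrier_mat n K" for Z
    using that by (simp add: frobenius_norm_def L2_set_def sum.cartesian_product case_prod_beta)
  have "frobenius_norm (X + Y)
      = L2_set (\<lambda>ij. (case ij of (i, j) \<Rightarrow> X $$ (i, j)) + (case ij of (i, j) \<Rightarrow> Y $$ (i, j)))
          ({..<n} \<times> {..<K})"
    using assms by (subst *) (auto intro!: L2_set_cong)
  also have "\<dots> \<le> frobenius_norm X + frobenius_norm Y"
    using assms by (simp add: * L2_set_triangle_ineq)
  finally show ?thesis .
qed

lemma frobenius_norm_minus_commute:
  assumes "X \<in> carrier_mat n K" "Y \<in> carrier_mat n K"
  shows "frobenius_norm (X - Y) = frobenius_norm (Y - X)"
  using assms by (auto simp: frobenius_norm_def power2_commute)

lemma frobenius_norm_label_mat_diff: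
  assumes "\<And>i. i < n \<Longrightarrow> s i < K" "\<And>i. i < n \<Longrightarrow> t i < K"
  shows "(frobenius_norm (label_mat n K s - label_mat n K t))\<^sup>2 = 2 * real (mislabelled n s t)"
proof -
  have row: "(\<Sum>k<K. (of_bool (a = k) - of_bool (b = k) :: real)\<^sup>2) = 2 * of_bool (a \<noteq> b)"
    if "a < K" "b < K" for a b
  proof -
    have "(\<Sum>k<K. (of_bool (a = k) - of_bool (b = k) :: real)\<^sup>2)
        = (\<Sum>k<K. of_bool (k = a) + of_bool (k = b) - 2 * of_bool (a = b) * of_bool (k = a))"
      by (intro sum.cong) (auto simp: power2_eq_square)
    then show ?thesis
      using that by (auto simp: sum.distrib sum_subtractf of_bool_def)
  qed
  have "(frobenius_norm (label_mat n K s - label_mat n K t))\<^sup>2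
      = (\<Sum>i<n. \<Sum>k<K. (of_bool (s i = k) - of_bool (t i = k) :: real)\<^sup>2)"
    by (simp add: frobenius_norm_sq)
  also have "\<dots> = (\<Sum>i<n. 2 * of_bool (s i \<noteq> t i))"
    using assms by (intro sum.cong row) auto
  finally show ?thesis
    by (simp only: sum_of_bool_card mislabelled_def flip: sum_distrib_left)
qed

lemma euclid_norm_sq: "(euclid_norm v)\<^sup>2 = (\<Sum>i<dim_vec v. (v $ i)\<^sup>2)"
  by (simp add: euclid_norm_def scalar_prod_def atLeast0LessThan power2_eq_square sum_nonneg)

lemma euclid_norm_nonneg [simp]: "euclid_norm v \<ge> 0"
  by (simp add: euclid_norm_def scalar_prod_def sum_nonneg)

lemma euclid_norm_smult: "euclid_norm (c \<cdot>\<^sub>v v) = \<bar>c\<bar> * euclid_norm v"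
  by (rule power2_eq_imp_eq)
     (simp_all add: euclid_norm_sq power_mult_distrib sum_distrib_left)

lemma euclid_norm_mult_mat_vec_le_frobenius:
  assumes "v \<in> carrier_vec (dim_col M)"
  shows "euclid_norm (M *\<^sub>v v) \<le> frobenius_norm M * euclid_norm v"
proof (rule power2_le_imp_le)
  have "(euclid_norm (M *\<^sub>v v))\<^sup>2 = (\<Sum>i<dim_row M. (\<Sum>j<dim_col M. M $$ (i, j) * v $ j)\<^sup>2)"
    using assms by (simp add: euclid_norm_sq scalar_prod_def atLeast0LessThan)
  also have "\<dots> \<le> (\<Sum>i<dim_row M. (\<Sum>j<dim_col M. (M $$ (i, j))\<^sup>2) * (\<Sum>j<dim_col M. (v $ j)\<^sup>2))"
    by (intro sum_mono Cauchy_Schwarz_ineq_sum)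
  also have "\<dots> = (frobenius_norm M * euclid_norm v)\<^sup>2"
    using assms by (simp add: power_mult_distrib frobenius_norm_sq euclid_norm_sq sum_distrib_right)
  finally show "(euclid_norm (M *\<^sub>v v))\<^sup>2 \<le> (frobenius_norm M * euclid_norm v)\<^sup>2" .
qed simp

lemma euclid_norm_mult_mat_vec_le:
  assumes v: "v \<in> carrier_vec (dim_col M)"
  shows "euclid_norm (M *\<^sub>v v) \<le> spectral_norm M * euclid_norm v"
proof (cases "euclid_norm v = 0")
  case True
  then show ?thesis
    using euclid_norm_mult_mat_vec_le_frobenius[OF v] by simp
next
  case False
  then have pos: "euclid_norm v > 0"
    by (simp add: order.not_eq_order_implies_strict)
  define u where "u = (1 / euclid_norm v) \<cdot>\<^sub>v v"
  have u: "u \<in> carrier_vec (dim_col M)" "euclid_norm u = 1"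
    using v pos by (auto simp: u_def euclid_norm_smult)
  have "euclid_norm (M *\<^sub>v u) \<le> spectral_norm M"
    unfolding spectral_norm_def
  proof (rule cSup_upper)
    show "bdd_above {euclid_norm (M *\<^sub>v v) |v. v \<in> carrier_vec (dim_col M) \<and> euclid_norm v = 1}"
      using euclid_norm_mult_mat_vec_le_frobenius[of _ M]
      by (intro bdd_aboveI[of _ "frobenius_norm M"]) fastforce
  qed (use u in auto)
  moreover have "M *\<^sub>v u = (1 / euclid_norm v) \<cdot>\<^sub>v (M *\<^sub>v v)"
    unfolding u_def by (rule mult_mat_vec[of _ "dim_row M" "dim_col M"]) (use v in auto)
  ultimately show ?thesis
    using pos by (simp add: euclid_norm_smult field_simps)
qed

lemma frobenius_norm_mult_le:
  assumes M: "M \<in> carrier_mat r n" and X: "X \<in> carrier_mat n K" and b: "spectral_norm M \<le> b"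
  shows "(\<Sum>i<r. \<Sum>k<K. (\<Sum>j<n. M $$ (i, j) * X $$ (j, k))\<^sup>2) \<le> b\<^sup>2 * (frobenius_norm X)\<^sup>2"
proof -
  have col: "(\<Sum>i<r. (\<Sum>j<n. M $$ (i, j) * X $$ (j, k))\<^sup>2) \<le> b\<^sup>2 * (\<Sum>j<n. (X $$ (j, k))\<^sup>2)"
    if k: "k < K" for k
  proof -
    let ?v = "col X k"
    have "euclid_norm (M *\<^sub>v ?v) \<le> spectral_norm M * euclid_norm ?v"
      using M X by (intro euclid_norm_mult_mat_vec_le) auto
    also have "\<dots> \<le> b * euclid_norm ?v"
      using b by (intro mult_right_mono) auto
    finally have "(euclid_norm (M *\<^sub>v ?v))\<^sup>2 \<le> (b * euclid_norm ?v)\<^sup>2"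
      by (intro power_mono) auto
    then show ?thesis
      using M X k by (simp add: power_mult_distrib euclid_norm_sq scalar_prod_def atLeast0LessThan)
  qed
  have "(\<Sum>i<r. \<Sum>k<K. (\<Sum>j<n. M $$ (i, j) * X $$ (j, k))\<^sup>2)
      = (\<Sum>k<K. \<Sum>i<r. (\<Sum>j<n. M $$ (i, j) * X $$ (j, k))\<^sup>2)"
    by (rule sum.swap)
  also have "\<dots> \<le> (\<Sum>k<K. b\<^sup>2 * (\<Sum>j<n. (X $$ (j, k))\<^sup>2))"
    using col by (intro sum_mono) auto
  also have "\<dots> = b\<^sup>2 * (frobenius_norm X)\<^sup>2"
    using X sum.swap[of "\<lambda>j k. (X $$ (j, k))\<^sup>2" "{..<K}" "{..<n}"]
    by (simp add: frobenius_norm_sq flip: sum_distrib_left)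
  finally show ?thesis .
qed

lemma expected_mat_log_sbm:
  assumes p: "0 \<le> \<alpha> * ln (real n) / real n" "\<alpha> * ln (real n) / real n \<le> 1"
    and q: "0 \<le> \<beta> * ln (real n) / real n" "\<beta> * ln (real n) / real n \<le> 1"
    and ij: "i < n" "j < n"
  shows "expected_mat n (log_sbm \<alpha> \<beta> n Hs) $$ (i, j) =
    (if Matrix.row Hs i = Matrix.row Hs j then \<alpha> else \<beta>) * ln (real n) / real n"
proof -
  let ?I = "{(i, j). i \<le> j \<and> j < n}"
  let ?r = "\<lambda>(i, j). if Matrix.row Hs i = Matrix.row Hs j then \<alpha> * ln (real n) / real n
    else \<beta> * ln (real n) / real n"
  let ?e = "(min i j, max i j)"
  have fin: "finite ?I"
    by (rule finite_subset[of _ "{..<n} \<times> {..<n}"]) auto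
  have e: "?e \<in> ?I" using ij by (auto simp: min_def max_def)
  have "expected_mat n (log_sbm \<alpha> \<beta> n Hs) $$ (i, j)
      = measure_pmf.expectation (Pi_pmf ?I False (\<lambda>x. bernoulli_pmf (?r x))) (\<lambda>E. of_bool (E ?e))"
    using ij by (simp add: expected_mat_def log_sbm_def sbm_def case_prod_unfold)
  also have "\<dots> = measure_pmf.expectation
      (map_pmf (\<lambda>E. E ?e) (Pi_pmf ?I False (\<lambda>x. bernoulli_pmf (?r x)))) of_bool"
    by simp
  also have "map_pmf (\<lambda>E. E ?e) (Pi_pmf ?I False (\<lambda>x. bernoulli_pmf (?r x))) = bernoulli_pmf (?r ?e)"
    by (subst Pi_pmf_component[OF fin]) (simp only: e if_True)
  also have "measure_pmf.expectation (bernoulli_pmf (?r ?e)) of_bool = ?r ?e"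
    using p q by auto
  finally show ?thesis
    by (auto simp: min_def max_def)
qed

lemma set_pmf_log_sbm: "A \<in> set_pmf (log_sbm \<alpha> \<beta> n Hs) \<Longrightarrow> A \<in> carrier_mat n n"
  by (auto simp: log_sbm_def sbm_def)

lemma expected_mat_carrier [simp]: "expected_mat n M \<in> carrier_mat n n"
  by (simp add: expected_mat_def)

lemma projectionE:
  assumes "H \<in> projection m K C"
  obtains t where "balanced_labelling m K t" "H = label_mat (m * K) K t"
  using assms feasible_mats_iff by (auto simp: projection_def is_arg_min_def)

lemma projection_le:
  assumes "H \<in> projection m K C" "balanced_labelling m K g"
  shows "frobenius_norm (H - C) \<le> frobenius_norm (label_mat (m * K) K g - C)"
  using assms feasible_mats_iff[of "label_mat (m * K) K g" m K]
  by (fastforce simp: projection_def is_arg_min_linorder)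

text \<open>All feasible matrices have the same Frobenius norm, so the projection maximises the inner
  product with \<open>C\<close>.\<close>

lemma projection_inner_ge:
  assumes t: "balanced_labelling m K t" and g: "balanced_labelling m K g"
    and C: "C \<in> carrier_mat (m * K) K"
    and proj: "label_mat (m * K) K t \<in> projection m K C"
  shows "(\<Sum>i<m * K. C $$ (i, g i)) \<le> (\<Sum>i<m * K. C $$ (i, t i))"
proof -
  let ?n = "m * K"
  have expand: "(frobenius_norm (label_mat ?n K s - C))\<^sup>2
      = real ?n + (\<Sum>i<?n. \<Sum>k<K. (C $$ (i, k))\<^sup>2) - 2 * (\<Sum>i<?n. C $$ (i, s i))"
    if s: "balanced_labelling m K s" for s
  proof -
    have row: "(\<Sum>k<K. (of_bool (s i = k) - C $$ (i, k))\<^sup>2)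
        = 1 + (\<Sum>k<K. (C $$ (i, k))\<^sup>2) - 2 * C $$ (i, s i)" if "i < ?n" for i
    proof -
      have "(\<Sum>k<K. (of_bool (s i = k) - C $$ (i, k))\<^sup>2)
          = (\<Sum>k<K. of_bool (s i = k) + (C $$ (i, k))\<^sup>2 - 2 * (if s i = k then C $$ (i, k) else 0))"
        by (intro sum.cong) (auto simp: power2_eq_square algebra_simps)
      then show ?thesis
        using balanced_labellingD(1)[OF s that]
        by (simp add: sum.distrib sum_subtractf of_bool_def flip: sum_distrib_left)
    qed
    have "(frobenius_norm (label_mat ?n K s - C))\<^sup>2
        = (\<Sum>i<?n. \<Sum>k<K. (of_bool (s i = k) - C $$ (i, k))\<^sup>2)"
      using C by (simp add: frobenius_norm_sq)
    also have "\<dots> = (\<Sum>i<?n. 1 + (\<Sum>k<K. (C $$ (i, k))\<^sup>2) - 2 * C $$ (i, s i))"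
      using row by (intro sum.cong) auto
    finally show ?thesis
      by (simp add: sum.distrib sum_subtractf flip: sum_distrib_left)
  qed
  have "(frobenius_norm (label_mat ?n K t - C))\<^sup>2 \<le> (frobenius_norm (label_mat ?n K g - C))\<^sup>2"
    using projection_le[OF proj g] by (intro power_mono) auto
  then show ?thesis
    by (simp add: expand t g)
qed

text \<open>The gap condition says that, up to the noise \<open>e\<close>, every row of \<open>C\<close> prefers its label
  under \<open>g\<close> by a margin \<open>\<delta>\<close>; optimality of \<open>t\<close> then forces the noise to pay for each
  mislabelled row.\<close>

lemma mislabelled_le_noise:
  fixes C e :: "nat \<Rightarrow> nat \<Rightarrow> real"
  assumes t: "\<And>i. i < n \<Longrightarrow> t i < K" and g: "\<And>i. i < n \<Longrightarrow> g i < K"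
    and opt: "(\<Sum>i<n. C i (g i)) \<le> (\<Sum>i<n. C i (t i))"
    and gap: "\<And>i l. i < n \<Longrightarrow> l < K \<Longrightarrow> l \<noteq> g i \<Longrightarrow> C i (g i) - C i l \<ge> \<delta> + e i (g i) - e i l"
    and noise: "(\<Sum>i<n. \<Sum>k<K. (e i k)\<^sup>2) \<le> B"
    and "\<delta> > 0"
  shows "\<delta>\<^sup>2 * real (mislabelled n t g) \<le> 2 * B"
proof -
  let ?S = "{i. i < n \<and> t i \<noteq> g i}"
  let ?D = "real (mislabelled n t g)"
  have S: "finite ?S" "?S \<subseteq> {..<n}" by auto
  have "(\<Sum>i<n. C i (g i) - C i (t i)) = (\<Sum>i\<in>?S. C i (g i) - C i (t i))"
    by (rule sum.mono_neutral_right) auto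
  then have "(\<Sum>i\<in>?S. C i (g i) - C i (t i)) \<le> 0"
    using opt by (simp add: sum_subtractf)
  moreover have "(\<Sum>i\<in>?S. \<delta> + e i (g i) - e i (t i)) \<le> (\<Sum>i\<in>?S. C i (g i) - C i (t i))"
    using gap t by (intro sum_mono) auto
  ultimately have "\<delta> * ?D \<le> (\<Sum>i\<in>?S. e i (t i) - e i (g i))"
    by (simp add: sum.distrib sum_subtractf mislabelled_def mult.commute)
  moreover have "0 \<le> \<delta> * ?D" using \<open>\<delta> > 0\<close> by simp
  ultimately have "(\<delta> * ?D)\<^sup>2 \<le> (\<Sum>i\<in>?S. (e i (t i) - e i (g i)) * 1)\<^sup>2"
    by (intro power_mono) auto
  also have "\<dots> \<le> (\<Sum>i\<in>?S. (e i (t i) - e i (g i))\<^sup>2) * (\<Sum>i\<in>?S. 1\<^sup>2)"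
    by (rule Cauchy_Schwarz_ineq_sum)
  also have "\<dots> = (\<Sum>i\<in>?S. (e i (t i) - e i (g i))\<^sup>2) * ?D"
    by (simp add: mislabelled_def)
  also have "(\<Sum>i\<in>?S. (e i (t i) - e i (g i))\<^sup>2) \<le> (\<Sum>i\<in>?S. 2 * (\<Sum>k<K. (e i k)\<^sup>2))"
  proof (rule sum_mono)
    fix i assume i: "i \<in> ?S"
    have "(e i (t i))\<^sup>2 + (e i (g i))\<^sup>2 = (\<Sum>k\<in>{t i, g i}. (e i k)\<^sup>2)"
      using i by auto
    also have "\<dots> \<le> (\<Sum>k<K. (e i k)\<^sup>2)"
      using i t g by (intro sum_mono2) auto
    finally have "2 * ((e i (t i))\<^sup>2 + (e i (g i))\<^sup>2) \<le> 2 * (\<Sum>k<K. (e i k)\<^sup>2)"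
      by (intro mult_left_mono) auto
    moreover have "(e i (t i) - e i (g i))\<^sup>2 \<le> 2 * ((e i (t i))\<^sup>2 + (e i (g i))\<^sup>2)"
      using zero_le_power2[of "e i (t i) + e i (g i)"]
      by (simp add: power2_eq_square algebra_simps)
    ultimately show "(e i (t i) - e i (g i))\<^sup>2 \<le> 2 * (\<Sum>k<K. (e i k)\<^sup>2)"
      by (rule order_trans[rotated])
  qed
  also have "(\<Sum>i\<in>?S. 2 * (\<Sum>k<K. (e i k)\<^sup>2)) \<le> (\<Sum>i<n. 2 * (\<Sum>k<K. (e i k)\<^sup>2))"
    using S by (intro sum_mono2) (auto intro!: sum_nonneg)
  also have "\<dots> \<le> 2 * B"
    using noise by (simp flip: sum_distrib_left)
  finally have le: "(\<delta> * ?D)\<^sup>2 \<le> 2 * B * ?D"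
    by (simp add: mult_right_mono)
  have "B \<ge> 0"
    using noise by (rule order_trans[rotated]) (auto intro!: sum_nonneg)
  show ?thesis
  proof (cases "?D = 0")
    case True
    then show ?thesis using \<open>B \<ge> 0\<close> by simp
  next
    case False
    then have "?D > 0" by simp
    moreover have "(\<delta>\<^sup>2 * ?D) * ?D \<le> 2 * B * ?D"
      using le by (simp add: power2_eq_square algebra_simps)
    ultimately show ?thesis by (simp only: mult_le_cancel_right_pos)
  qed
qed

lemma signal_gap:
  assumes s: "balanced_labelling m K s" and g: "balanced_labelling m K g"
    and i: "i < m * K" and l: "l < K" "l \<noteq> g i" and ab: "b \<le> a"
  defines "u \<equiv> \<lambda>k. \<Sum>j<m * K. (if g i = g j then a else b) * (of_bool (s j = k) - of_bool (g j = k))"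
  shows "u (g i) - u l \<ge> - (a - b) * real (mislabelled (m * K) s g)"
proof -
  let ?n = "m * K"
  define c where "c k = (\<Sum>j<?n. of_bool (g i = g j) * (of_bool (s j = k) - of_bool (g j = k)) :: real)" for k
  have u: "u k = (a - b) * c k" if "k < K" for k
  proof -
    have "u k = (\<Sum>j<?n. (a - b) * (of_bool (g i = g j) * (of_bool (s j = k) - of_bool (g j = k)))
        + b * (of_bool (s j = k) - of_bool (g j = k)))"
      unfolding u_def by (intro sum.cong) (auto simp: algebra_simps)
    also have "\<dots> = (a - b) * c k + b * ((\<Sum>j<?n. of_bool (s j = k)) - (\<Sum>j<?n. of_bool (g j = k)))"
      by (simp only: sum.distrib sum_subtractf c_def flip: sum_distrib_left)
    finally show ?thesis
      using balanced_labellingD(3)[OF s that] balanced_labellingD(3)[OF g that] by simp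
  qed
  have gi: "g i < K" using balanced_labellingD(1)[OF g i] .
  have "(\<Sum>j<?n. of_bool (s j = g i) :: real) = (\<Sum>j<?n. of_bool (g j = g i))"
    using balanced_labellingD(3)[OF s gi] balanced_labellingD(3)[OF g gi] by simp
  then have "c l - c (g i) = c l - c (g i) + ((\<Sum>j<?n. of_bool (s j = g i)) - (\<Sum>j<?n. of_bool (g j = g i)))"
    by simp
  also have "\<dots> = (\<Sum>j<?n. of_bool (g i = g j) * (of_bool (s j = l) - of_bool (g j = l))
        - of_bool (g i = g j) * (of_bool (s j = g i) - of_bool (g j = g i))
        + (of_bool (s j = g i) - of_bool (g j = g i)))"
    by (simp only: c_def sum.distrib sum_subtractf)
  also have "\<dots> \<le> (\<Sum>j<?n. of_bool (s j \<noteq> g j))"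
    using l by (intro sum_mono) auto
  also have "\<dots> = real (mislabelled ?n s g)"
    by (simp only: sum_of_bool_card mislabelled_def)
  finally have "(a - b) * (c l - c (g i)) \<le> (a - b) * real (mislabelled ?n s g)"
    using ab by (intro mult_left_mono) auto
  moreover have "u (g i) - u l = - ((a - b) * (c l - c (g i)))"
    by (simp only: u[OF gi] u[OF l(1)]) (simp add: algebra_simps)
  ultimately show ?thesis by (simp only: minus_mult_left[symmetric] neg_le_iff_le)
qed

lemma ppm_step_contraction:
  assumes s: "balanced_labelling m K s" and g: "balanced_labelling m K g"
    and t: "balanced_labelling m K t"
    and A: "A \<in> carrier_mat (m * K) (m * K)" and P: "P \<in> carrier_mat (m * K) (m * K)"
    and P_val: "\<And>i j. i < m * K \<Longrightarrow> j < m * K \<Longrightarrow> P $$ (i, j) = (if g i = g j then a else b)"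
    and ab: "b \<le> a"
    and conc: "spectral_norm (A - P) \<le> \<epsilon>"
    and sep: "\<And>i l. i < m * K \<Longrightarrow> l < K \<Longrightarrow> l \<noteq> g i \<Longrightarrow>
       (\<Sum>j<m * K. A $$ (i, j) * of_bool (g j = g i)) - (\<Sum>j<m * K. A $$ (i, j) * of_bool (g j = l)) \<ge> \<eta>"
    and \<delta>: "0 < \<delta>" "\<delta> \<le> \<eta> - (a - b) * real (mislabelled (m * K) s g)"
    and proj: "label_mat (m * K) K t \<in> projection m K (A * label_mat (m * K) K s)"
  shows "\<delta>\<^sup>2 * real (mislabelled (m * K) t g) \<le> 4 * \<epsilon>\<^sup>2 * real (mislabelled (m * K) s g)"
proof -
  let ?n = "m * K"
  let ?X = "label_mat ?n K s - label_mat ?n K g"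
  define C where "C i k = (\<Sum>j<?n. A $$ (i, j) * of_bool (s j = k))" for i k
  define e where "e i k = (\<Sum>j<?n. (A - P) $$ (i, j) * ?X $$ (j, k))" for i k
  define u where "u i k = (\<Sum>j<?n. (if g i = g j then a else b) * (of_bool (s j = k) - of_bool (g j = k)))"
    for i k
  have C: "(A * label_mat ?n K s) $$ (i, k) = C i k" if "i < ?n" "k < K" for i k
    using A that by (simp add: C_def scalar_prod_def atLeast0LessThan)
  have split: "C i k = (\<Sum>j<?n. A $$ (i, j) * of_bool (g j = k)) + e i k + u i k"
    if "i < ?n" "k < K" for i k
    unfolding C_def e_def u_def sum.distrib[symmetric]
    using that A P by (intro sum.cong) (auto simp: P_val algebra_simps)
  have opt: "(\<Sum>i<?n. C i (g i)) \<le> (\<Sum>i<?n. C i (t i))"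
    using projection_inner_ge[OF t g _ proj] A C balanced_labellingD(1)[OF t] balanced_labellingD(1)[OF g]
    by auto
  have "(\<Sum>i<?n. \<Sum>k<K. (e i k)\<^sup>2) \<le> \<epsilon>\<^sup>2 * (frobenius_norm ?X)\<^sup>2"
    unfolding e_def using A P conc by (intro frobenius_norm_mult_le) auto
  also have "\<dots> = 2 * \<epsilon>\<^sup>2 * real (mislabelled ?n s g)"
    using balanced_labellingD(1)[OF s] balanced_labellingD(1)[OF g]
    by (subst frobenius_norm_label_mat_diff) auto
  finally have noise: "(\<Sum>i<?n. \<Sum>k<K. (e i k)\<^sup>2) \<le> 2 * \<epsilon>\<^sup>2 * real (mislabelled ?n s g)" .
  have gap: "C i (g i) - C i l \<ge> \<delta> + e i (g i) - e i l" if "i < ?n" "l < K" "l \<noteq> g i" for i l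
  proof -
    have "u i (g i) - u i l \<ge> - (a - b) * real (mislabelled ?n s g)"
      unfolding u_def using signal_gap[OF s g that ab] .
    then show ?thesis
      using split[OF that(1,2)] split[OF that(1) balanced_labellingD(1)[OF g that(1)]] sep[OF that] \<delta>
      by (simp add: algebra_simps)
  qed
  have "\<delta>\<^sup>2 * real (mislabelled ?n t g) \<le> 2 * (2 * \<epsilon>\<^sup>2 * real (mislabelled ?n s g))"
    using balanced_labellingD(1)[OF t] balanced_labellingD(1)[OF g] opt gap noise \<delta>(1)
    by (rule mislabelled_le_noise)
  then show ?thesis by simp
qed

lemma projection_initial:
  assumes g: "balanced_labelling m K g" and t: "balanced_labelling m K t"
    and H0: "H0 \<in> carrier_mat (m * K) K"
    and proj: "label_mat (m * K) K t \<in> projection m K H0"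
    and close: "frobenius_norm (H0 - label_mat (m * K) K g) \<le> r"
  shows "real (mislabelled (m * K) t g) \<le> 2 * r\<^sup>2"
proof -
  let ?n = "m * K"
  let ?T = "label_mat ?n K t" and ?G = "label_mat ?n K g"
  have "?T - ?G = (?T - H0) + (H0 - ?G)"
    using H0 by (intro eq_matI) auto
  then have "frobenius_norm (?T - ?G) \<le> frobenius_norm (?T - H0) + frobenius_norm (H0 - ?G)"
    using frobenius_norm_triangle[OF minus_carrier_mat[OF H0] minus_carrier_mat[OF label_mat_carrier],
        of ?T H0 g] by simp
  also have "frobenius_norm (?T - H0) \<le> frobenius_norm (?G - H0)"
    by (rule projection_le[OF proj g])
  also have "frobenius_norm (?G - H0) = frobenius_norm (H0 - ?G)"
    using H0 by (intro frobenius_norm_minus_commute) auto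
  finally have "frobenius_norm (?T - ?G) \<le> 2 * r"
    using close by simp
  then have "(frobenius_norm (?T - ?G))\<^sup>2 \<le> (2 * r)\<^sup>2"
    by (intro power_mono) auto
  then show ?thesis
    using balanced_labellingD(1)[OF g] balanced_labellingD(1)[OF t]
    by (simp add: frobenius_norm_label_mat_diff)
qed

lemma balanced_labelling_permute:
  assumes s: "balanced_labelling m K s" and \<pi>: "\<pi> permutes {..<K}"
  shows "balanced_labelling m K (\<pi> \<circ> s)"
proof -
  have "\<pi> (s i) < K" if "i < m * K" for i
    using balanced_labellingD(1)[OF s that] permutes_in_image[OF \<pi>] by auto
  moreover have "card {i. i < m * K \<and> \<pi> (s i) = k} = m" if "k < K" for k
  proof -
    have "inv_into UNIV \<pi> k < K"
      using permutes_in_image[OF permutes_inv[OF \<pi>]] that by auto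
    moreover have "\<pi> x = k \<longleftrightarrow> x = inv_into UNIV \<pi> k" for x
      using permutes_inverses[OF \<pi>] by metis
    ultimately show ?thesis
      using balanced_labellingD(2)[OF s] by simp
  qed
  ultimately show ?thesis by (auto simp: balanced_labelling_def)
qed

lemma label_mat_mult_permutation:
  assumes s: "\<And>i. i < n \<Longrightarrow> s i < K" and \<pi>: "\<pi> permutes {..<K}"
  shows "label_mat n K s * Matrix.mat K K (\<lambda>(i, j). if j = \<pi> i then 1 else 0) = label_mat n K (\<pi> \<circ> s)"
proof (rule eq_matI)
  fix i j assume "i < dim_row (label_mat n K (\<pi> \<circ> s))" "j < dim_col (label_mat n K (\<pi> \<circ> s))"
  then have ij: "i < n" "j < K" by auto
  have "(label_mat n K s * Matrix.mat K K (\<lambda>(i, j). if j = \<pi> i then 1 else 0)) $$ (i, j)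
      = (\<Sum>k<K. if k = s i then of_bool (\<pi> k = j) else 0)"
    using ij by (auto simp: scalar_prod_def atLeast0LessThan intro!: sum.cong)
  then show "(label_mat n K s * Matrix.mat K K (\<lambda>(i, j). if j = \<pi> i then 1 else 0)) $$ (i, j)
      = label_mat n K (\<pi> \<circ> s) $$ (i, j)"
    using ij s by simp
qed auto

lemma power_le_exp_minus:
  fixes L r :: real
  assumes L: "L > 1" and r: "0 \<le> r" "r\<^sup>2 \<le> 1 / L" and N: "real N \<ge> 2 * L / ln L"
  shows "r ^ N \<le> exp (- L)"
proof -
  have lnL: "ln L > 0" using L by simp
  have "r \<le> exp (- ln L / 2)"
  proof (rule power2_le_imp_le)
    have "(exp (- ln L / 2))\<^sup>2 = exp (2 * (- ln L / 2))"
      by (rule exp_double[symmetric])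
    also have "2 * (- ln L / 2) = - ln L" by simp
    also have "exp (- ln L) = 1 / L"
      using L by (simp add: exp_minus inverse_eq_divide)
    finally show "r\<^sup>2 \<le> (exp (- ln L / 2))\<^sup>2" using r by simp
  qed simp
  then have "r ^ N \<le> exp (- ln L / 2) ^ N"
    using r by (intro power_mono) auto
  also have "\<dots> = exp (- (real N * ln L / 2))"
    by (subst exp_of_nat_mult[symmetric]) simp
  also have "\<dots> \<le> exp (- L)"
    using N lnL by (simp add: pos_divide_le_eq mult.commute)
  finally show ?thesis .
qed

lemma ppm_recovers:
  fixes \<alpha> \<beta> c1 \<gamma> \<theta> :: real and n :: nat
  defines "L \<equiv> ln (real n)"
  assumes n: "n = m * K" "n > 0" and ab: "\<alpha> > \<beta>"
    and \<gamma>: "\<gamma> > 0"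
    and \<theta>: "0 \<le> \<theta>" "\<theta> < 1 / 2" "20 * (\<alpha> - \<beta>) * \<theta>\<^sup>2 \<le> \<gamma>"
    and L: "L > 1" "64 * c1\<^sup>2 / \<gamma>\<^sup>2 \<le> L" "256 * c1 ^ 4 / \<gamma> ^ 4 \<le> L"
    and g: "balanced_labelling m K g"
    and A: "A \<in> carrier_mat n n" and P: "P \<in> carrier_mat n n"
    and P_val: "\<And>i j. i < n \<Longrightarrow> j < n \<Longrightarrow>
      P $$ (i, j) = (if g i = g j then \<alpha> else \<beta>) * L / real n"
    and conc: "spectral_norm (A - P) \<le> c1 * sqrt (L)"
    and sep: "\<And>i l. i < n \<Longrightarrow> l < K \<Longrightarrow> l \<noteq> g i \<Longrightarrow>
       (\<Sum>j<n. A $$ (i, j) * of_bool (g j = g i)) - (\<Sum>j<n. A $$ (i, j) * of_bool (g j = l)) \<ge> \<gamma> * L"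
    and H0: "H0 \<in> carrier_mat n K"
    and close: "frobenius_norm (H0 - label_mat n K g) \<le> \<theta> * sqrt (real n)"
    and N: "real N \<ge> 2 * L / ln (L)"
    and out: "ppm_output m K A N H0 H"
  shows "H = label_mat n K g"
proof -
  define D where "D s = real (mislabelled n s g)" for s
  define r where "r = 5 * c1\<^sup>2 / (\<gamma>\<^sup>2 * L)"
  have r0: "r \<ge> 0" using L(1) by (simp add: r_def)
  have r1: "r \<le> 1"
  proof -
    have "64 * c1\<^sup>2 \<le> \<gamma>\<^sup>2 * L" using L(2) \<gamma> by (simp add: pos_divide_le_eq mult.commute)
    moreover have "0 \<le> c1\<^sup>2" by simp
    ultimately have "5 * c1\<^sup>2 \<le> \<gamma>\<^sup>2 * L" by linarith
    then show ?thesis using L(1) \<gamma> by (simp add: r_def)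
  qed
  have r2: "r\<^sup>2 \<le> 1 / L"
  proof -
    have "256 * c1 ^ 4 \<le> \<gamma> ^ 4 * L" using L(3) \<gamma> by (simp add: pos_divide_le_eq mult.commute)
    moreover have "0 \<le> c1 ^ 4" by simp
    ultimately have "25 * c1 ^ 4 \<le> \<gamma> ^ 4 * L" by linarith
    then have "25 * c1 ^ 4 / (\<gamma> ^ 4 * (L)\<^sup>2) \<le> \<gamma> ^ 4 * L / (\<gamma> ^ 4 * (L)\<^sup>2)"
      using L(1) \<gamma> by (intro divide_right_mono) auto
    also have "\<dots> = 1 / L" using L(1) \<gamma> by (simp add: power2_eq_square)
    also have "25 * c1 ^ 4 / (\<gamma> ^ 4 * (L)\<^sup>2) = r\<^sup>2"
      by (simp add: r_def power_divide power_mult_distrib flip: power_mult)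
    finally show ?thesis .
  qed
  from out obtain X where X1: "X 1 \<in> projection m K H0"
    and XS: "\<And>k. 1 \<le> k \<Longrightarrow> k \<le> N \<Longrightarrow> X (Suc k) \<in> projection m K (A * X k)"
    and HX: "H = X (Suc N)"
    by (auto simp: ppm_output_def)
  have step: "D t \<le> r * D s"
    if s: "balanced_labelling m K s" and t: "balanced_labelling m K t"
      and Ds: "D s \<le> 2 * \<theta>\<^sup>2 * real n"
      and proj: "label_mat n K t \<in> projection m K (A * label_mat n K s)" for s t
  proof -
    define \<delta> where "\<delta> = 9 / 10 * (\<gamma> * L)"
    have \<delta>: "\<delta> > 0" using \<gamma> L(1) by (simp add: \<delta>_def)
    have "(\<alpha> - \<beta>) * L / real n * D s \<le> (\<alpha> - \<beta>) * L / real n * (2 * \<theta>\<^sup>2 * real n)"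
      using Ds ab L(1) by (intro mult_left_mono) auto
    also have "\<dots> = (20 * (\<alpha> - \<beta>) * \<theta>\<^sup>2) * L / 10"
      using n by simp
    also have "\<dots> \<le> \<gamma> * L / 10"
      using \<theta>(3) L(1) by (intro divide_right_mono mult_right_mono) auto
    also have "(\<alpha> - \<beta>) * L / real n = \<alpha> * L / real n - \<beta> * L / real n"
      by (simp add: diff_divide_distrib left_diff_distrib)
    finally have margin: "\<delta> \<le> \<gamma> * L - (\<alpha> * L / real n - \<beta> * L / real n) * D s"
      unfolding \<delta>_def by linarith
    have P_val': "P $$ (i, j) = (if g i = g j then \<alpha> * L / real n else \<beta> * L / real n)"
      if "i < n" "j < n" for i j
      using P_val[OF that] by simp
    have le: "\<beta> * L / real n \<le> \<alpha> * L / real n"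
      using ab L(1) by (intro divide_right_mono mult_right_mono) auto
    have "\<delta>\<^sup>2 * D t \<le> 4 * (c1 * sqrt (L))\<^sup>2 * D s"
      unfolding D_def
      by (rule ppm_step_contraction[OF s g t, folded n(1),
            OF A P P_val' le conc sep \<delta> margin[unfolded D_def] proj])
    also have "\<dots> = 4 * c1\<^sup>2 * L * D s"
      using L(1) by (simp add: power_mult_distrib)
    finally have "\<delta>\<^sup>2 * D t \<le> 4 * c1\<^sup>2 * L * D s" .
    then have "D t \<le> 4 * c1\<^sup>2 * L * D s / \<delta>\<^sup>2"
      using \<delta> by (simp add: pos_le_divide_eq mult.commute)
    also have "\<dots> = (400 / 405) * (r * D s)"
      using \<gamma> L(1) by (simp add: \<delta>_def r_def power_mult_distrib power2_eq_square)
    also have "\<dots> \<le> r * D s"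
      using r0 by (intro mult_left_le_one_le) (auto simp: D_def)
    finally show ?thesis .
  qed
  have "\<exists>s. balanced_labelling m K s \<and> X (Suc k) = label_mat n K s \<and> D s \<le> r ^ k * (2 * \<theta>\<^sup>2 * real n)"
    if "k \<le> N" for k
    using that
  proof (induction k)
    case 0
    obtain t where t: "balanced_labelling m K t" "X 1 = label_mat n K t"
      using projectionE[OF X1] n(1) by metis
    have "D t \<le> 2 * (\<theta> * sqrt (real n))\<^sup>2"
      unfolding D_def
      by (rule projection_initial[OF g t(1), folded n(1), OF H0 _ close]) (use X1 t in simp)
    then have "D t \<le> 2 * \<theta>\<^sup>2 * real n"
      by (simp add: power_mult_distrib)
    then show ?case using t by auto
  next
    case (Suc k)
    then obtain s where s: "balanced_labelling m K s" "X (Suc k) = label_mat n K s"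
      and Ds: "D s \<le> r ^ k * (2 * \<theta>\<^sup>2 * real n)" by auto
    have proj: "X (Suc (Suc k)) \<in> projection m K (A * label_mat n K s)"
      using XS[of "Suc k"] Suc.prems s(2) by simp
    obtain t where t: "balanced_labelling m K t" "X (Suc (Suc k)) = label_mat n K t"
      using projectionE[OF proj] n(1) by metis
    have "r ^ k * (2 * \<theta>\<^sup>2 * real n) \<le> 2 * \<theta>\<^sup>2 * real n"
      using r0 r1 by (intro mult_left_le_one_le power_le_one) auto
    then have "D t \<le> r * D s"
      using Ds proj t by (intro step[OF s(1)]) auto
    also have "\<dots> \<le> r * (r ^ k * (2 * \<theta>\<^sup>2 * real n))"
      using Ds r0 by (intro mult_left_mono)
    finally show ?case using t by (auto simp: mult.assoc)
  qed
  from this[of N] obtain s where s: "H = label_mat n K s" and Ds: "D s \<le> r ^ N * (2 * \<theta>\<^sup>2 * real n)"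
    using HX by auto
  note Ds
  also have "r ^ N * (2 * \<theta>\<^sup>2 * real n) \<le> exp (- L) * (2 * \<theta>\<^sup>2 * real n)"
    using power_le_exp_minus[OF L(1) r0 r2 N] by (intro mult_right_mono) auto
  also have "\<dots> = 2 * \<theta>\<^sup>2"
    using n(2) by (simp add: L_def exp_minus)
  also have "\<dots> < 2 * (1 / 2)\<^sup>2"
    using \<theta>(1,2) by (intro mult_strict_left_mono power_strict_mono) auto
  finally have "mislabelled n s g = 0"
    by (simp add: D_def power2_eq_square)
  then have "s i = g i" if "i < n" for i
    using that by (auto simp: mislabelled_def)
  then show ?thesis
    unfolding s by (rule label_mat_cong)
qed

lemma prob_Int_ge:
  assumes "measure_pmf.prob M E \<ge> 1 - a" "measure_pmf.prob M F \<ge> 1 - b"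
  shows "measure_pmf.prob M (E \<inter> F) \<ge> 1 - (a + b)"
proof -
  have "measure_pmf.prob M (E \<inter> F) = measure_pmf.prob M E - measure_pmf.prob M (E - F)"
    using measure_pmf.finite_measure_Diff'[of E M F] by simp
  moreover have "measure_pmf.prob M (E - F) \<le> measure_pmf.prob M (- F)"
    by (rule measure_pmf.finite_measure_mono) auto
  moreover have "measure_pmf.prob M (- F) = 1 - measure_pmf.prob M F"
    using measure_pmf.prob_compl[of F M] by (simp add: Compl_eq_Diff_UNIV)
  ultimately show ?thesis
    using assms by linarith
qed

lemma row_label_mat_eq_iff:
  assumes "i < n" "j < n" "s i < K"
  shows "Matrix.row (label_mat n K s) i = Matrix.row (label_mat n K s) j \<longleftrightarrow> s i = s j"
proof
  assume "Matrix.row (label_mat n K s) i = Matrix.row (label_mat n K s) j"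
  then have "Matrix.row (label_mat n K s) i $ s i = Matrix.row (label_mat n K s) j $ s i" by simp
  then show "s i = s j" using assms by (simp split: if_splits)
next
  assume "s i = s j"
  then show "Matrix.row (label_mat n K s) i = Matrix.row (label_mat n K s) j"
    using assms by (intro eq_vecI) auto
qed

lemma iteration_bound_ge: "real (iteration_bound n) \<ge> 2 * ln (real n) / ln (ln (real n))"
proof -
  have "2 * ln (real n) / ln (ln (real n)) \<le> real (nat \<lceil>2 * ln (real n) / ln (ln (real n))\<rceil>)"
    by (rule real_nat_ceiling_ge)
  then show ?thesis
    unfolding iteration_bound_def of_nat_add by simp
qed

lemma radius_bounds:
  fixes \<gamma> d :: real
  assumes K: "K \<ge> 1" and d: "d > 0" and \<gamma>: "\<gamma> > 0"
    and \<theta>: "\<theta> = 1 / 4 * min (1 / sqrt (real K)) (\<gamma> * sqrt (real K) / (16 * d))"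
  shows "0 \<le> \<theta>" "\<theta> < 1 / 2" "20 * d * \<theta>\<^sup>2 \<le> \<gamma>"
proof -
  have sK: "sqrt (real K) \<ge> 1" using K by simp
  show \<theta>0: "0 \<le> \<theta>"
    using d \<gamma> by (simp add: \<theta>)
  have le: "\<theta> \<le> 1 / 4 * (1 / sqrt (real K))" "\<theta> \<le> 1 / 4 * (\<gamma> * sqrt (real K) / (16 * d))"
    unfolding \<theta> by (rule mult_left_mono, simp, simp)+
  have "1 / sqrt (real K) \<le> 1" using sK by simp
  then show "\<theta> < 1 / 2" using le(1) by linarith
  have "\<theta> * \<theta> \<le> 1 / 4 * (1 / sqrt (real K)) * (1 / 4 * (\<gamma> * sqrt (real K) / (16 * d)))"
    using le \<theta>0 by (intro mult_mono) auto
  also have "\<dots> = \<gamma> / (256 * d)"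
    using sK by simp
  finally have "d * \<theta>\<^sup>2 \<le> d * (\<gamma> / (256 * d))"
    using d unfolding power2_eq_square by (intro mult_left_mono) auto
  also have "\<dots> = \<gamma> / 256" using d by simp
  finally show "20 * d * \<theta>\<^sup>2 \<le> \<gamma>" using \<gamma> by simp
qed

lemma separation_permute:
  assumes s: "balanced_labelling m K s" and \<pi>: "\<pi> permutes {..<K}"
    and n: "n = m * K" and A: "A \<in> carrier_mat n n"
    and sep: "\<forall>k<K. \<forall>l<K. k \<noteq> l \<longrightarrow> (\<forall>i<n. label_mat n K s $$ (i, k) = 1 \<longrightarrow>
      (A * label_mat n K s) $$ (i, k) - (A * label_mat n K s) $$ (i, l) \<ge> \<eta>)"
    and i: "i < n" and l: "l < K" "l \<noteq> (\<pi> \<circ> s) i"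
  shows "(\<Sum>j<n. A $$ (i, j) * of_bool ((\<pi> \<circ> s) j = (\<pi> \<circ> s) i))
    - (\<Sum>j<n. A $$ (i, j) * of_bool ((\<pi> \<circ> s) j = l)) \<ge> \<eta>"
proof -
  obtain l' where l': "l' < K" "l = \<pi> l'"
    using permutes_image[OF \<pi>] l(1) by blast
  have si: "s i < K" using balanced_labellingD(1)[OF s] i n by simp
  have inj: "\<pi> x = \<pi> y \<longleftrightarrow> x = y" for x y
    using permutes_inj[OF \<pi>] by (auto dest: injD)
  have prod: "(A * label_mat n K s) $$ (i, k) = (\<Sum>j<n. A $$ (i, j) * of_bool (s j = k))"
    if "k < K" for k
    using A i that by (simp add: scalar_prod_def atLeast0LessThan)
  have "(A * label_mat n K s) $$ (i, s i) - (A * label_mat n K s) $$ (i, l') \<ge> \<eta>"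
    using sep si l' l i by auto
  then show ?thesis
    by (simp only: prod si l'(1)) (simp only: l'(2) o_apply inj)
qed

lemma eventually_log_sbm_regime:
  fixes \<alpha> \<beta> c :: real
  assumes "c > 0"
  shows "\<forall>\<^sub>F n in sequentially. ln (real n) > 1 \<and> \<alpha> * ln (real n) / real n \<le> 1 \<and>
    \<beta> * ln (real n) / real n \<le> 1 \<and> real n powr (-c) \<le> 1 / 2"
proof -
  have small: "\<forall>\<^sub>F n in sequentially. a * ln (real n) / real n \<le> 1" for a :: real
  proof -
    have "(\<lambda>n. a * (ln (real n) / real n)) \<longlonglongrightarrow> a * 0"
      by (intro tendsto_mult tendsto_const lim_ln_over_n)
    then have "\<forall>\<^sub>F n in sequentially. a * (ln (real n) / real n) < 1"
      by (rule order_tendstoD) simp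
    then show ?thesis by eventually_elim simp
  qed
  have "filterlim (\<lambda>n. ln (real n)) at_top sequentially"
    by (rule filterlim_compose[OF ln_at_top filterlim_real_sequentially])
  then have "\<forall>\<^sub>F n in sequentially. ln (real n) > 1"
    by (simp add: filterlim_at_top_dense)
  moreover have "(\<lambda>n. real n powr (-c)) \<longlonglongrightarrow> 0"
    by (rule tendsto_neg_powr[OF _ filterlim_real_sequentially]) (use assms in simp)
  then have "\<forall>\<^sub>F n in sequentially. real n powr (-c) < 1 / 2"
    by (rule order_tendstoD) simp
  ultimately show ?thesis
    using small[of \<alpha>] small[of \<beta>] by eventually_elim simp
qed

theorem theorem2:
  fixes K :: nat and \<alpha> \<beta> c1 \<gamma> \<phi> \<theta> :: real
  assumes "K \<ge> 2" and "\<alpha> > 0" and "\<beta> > 0"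
    and "sqrt \<alpha> - sqrt \<beta> > sqrt (real K)"
    and "concentration_const \<alpha> \<beta> K c1"
    and "separation_const \<alpha> \<beta> K \<gamma>"
    and "\<phi> = c1 * sqrt (real K) / (16 * (\<alpha> - \<beta>))"
    and "\<theta> = 1 / 4 * min (1 / sqrt (real K)) (\<gamma> * sqrt (real K) / (16 * (\<alpha> - \<beta>)))"
  shows "\<exists>c>0. \<exists>n0::nat. \<forall>n m Hs.
    m > 0 \<and> n = m * K \<and> n \<ge> n0 \<and>
    real n > exp (Max {64 * c1\<^sup>2 / \<gamma>\<^sup>2, \<gamma>\<^sup>2 / c1\<^sup>2, 4 * sqrt 2 * \<phi> / sqrt \<gamma>, 256 * c1 ^ 4 / \<gamma> ^ 4}) \<and>
    Hs \<in> balanced_clustering_mats m K \<longrightarrow>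
    measure_pmf.prob (log_sbm \<alpha> \<beta> n Hs)
      {A. \<forall>H0 \<in> clustering_mats n K. \<forall>Q \<in> permutation_mats K.
            frobenius_norm (H0 - Hs * Q) \<le> \<theta> * sqrt (real n) \<longrightarrow>
            (\<forall>H. ppm_output m K A (iteration_bound n) H0 H \<longrightarrow> H = Hs * Q)}
    \<ge> 1 - real n powr (-c)"
proof -
  from assms(5) obtain nC where c1: "c1 > 0" and conc: "\<And>n m Hs. m > 0 \<and> n = m * K \<and> n \<ge> nC \<and>
      Hs \<in> balanced_clustering_mats m K \<Longrightarrow> measure_pmf.prob (log_sbm \<alpha> \<beta> n Hs)
      {A. spectral_norm (A - expected_mat n (log_sbm \<alpha> \<beta> n Hs)) \<le> c1 * sqrt (ln (real n))}
        \<ge> 1 - real n powr (-3)"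
    unfolding concentration_const_def by blast
  from assms(6) obtain c nS where \<gamma>: "\<gamma> > 0" and c: "c > 0" and sep: "\<And>n m Hs. m > 0 \<and> n = m * K \<and>
      n \<ge> nS \<and> Hs \<in> balanced_clustering_mats m K \<Longrightarrow> measure_pmf.prob (log_sbm \<alpha> \<beta> n Hs)
          {A. \<forall>k<K. \<forall>l<K. k \<noteq> l \<longrightarrow> (\<forall>i<n. Hs $$ (i, k) = 1 \<longrightarrow>
                (A * Hs) $$ (i, k) - (A * Hs) $$ (i, l) \<ge> \<gamma> * ln (real n))}
        \<ge> 1 - real n powr (-c)"
    unfolding separation_const_def by blast
  have "sqrt \<beta> < sqrt \<alpha>"
    using assms(4) real_sqrt_ge_zero[of "real K"] by linarith
  then have ab: "\<beta> < \<alpha>" by simp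
  have K: "K \<ge> 1" using assms(1) by simp
  note \<theta> = radius_bounds[OF K _ \<gamma> assms(8)]
  define c' where "c' = min 3 c / 2"
  have c': "c' > 0" "2 * c' \<le> 3" "2 * c' \<le> c" using c by (auto simp: c'_def)
  obtain n1 where n1: "\<And>n. n \<ge> n1 \<Longrightarrow> ln (real n) > 1 \<and> \<alpha> * ln (real n) / real n \<le> 1 \<and>
    \<beta> * ln (real n) / real n \<le> 1 \<and> real n powr (-c') \<le> 1 / 2"
    using eventually_log_sbm_regime[OF c'(1), of \<alpha> \<beta>] unfolding eventually_sequentially by blast
  show ?thesis
  proof (intro exI[of _ c'] conjI c' exI[of _ "max nC (max nS n1)"] allI impI, elim conjE)
    fix n m :: nat and Hs :: "real mat"
    assume m: "m > 0" and n: "n = m * K" and n_ge: "n \<ge> max nC (max nS n1)"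
      and large: "real n > exp (Max {64 * c1\<^sup>2 / \<gamma>\<^sup>2, \<gamma>\<^sup>2 / c1\<^sup>2, 4 * sqrt 2 * \<phi> / sqrt \<gamma>, 256 * c1 ^ 4 / \<gamma> ^ 4})"
      and Hs: "Hs \<in> balanced_clustering_mats m K"
    let ?M = "log_sbm \<alpha> \<beta> n Hs"
    let ?E = "{A. spectral_norm (A - expected_mat n ?M) \<le> c1 * sqrt (ln (real n))}"
    let ?F = "{A. \<forall>k<K. \<forall>l<K. k \<noteq> l \<longrightarrow> (\<forall>i<n. Hs $$ (i, k) = 1 \<longrightarrow>
                (A * Hs) $$ (i, k) - (A * Hs) $$ (i, l) \<ge> \<gamma> * ln (real n))}"
    let ?G = "{A. \<forall>H0 \<in> clustering_mats n K. \<forall>Q \<in> permutation_mats K.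
            frobenius_norm (H0 - Hs * Q) \<le> \<theta> * sqrt (real n) \<longrightarrow>
            (\<forall>H. ppm_output m K A (iteration_bound n) H0 H \<longrightarrow> H = Hs * Q)}"
    have L: "ln (real n) > 1" and p1: "\<alpha> * ln (real n) / real n \<le> 1"
      and q1: "\<beta> * ln (real n) / real n \<le> 1" and half: "real n powr (-c') \<le> 1 / 2"
      using n1[of n] n_ge by auto
    have p0: "0 \<le> \<alpha> * ln (real n) / real n" and q0: "0 \<le> \<beta> * ln (real n) / real n"
      using L assms(2,3) by auto
    have n0: "n > 0" using m K n by simp
    have "Max {64 * c1\<^sup>2 / \<gamma>\<^sup>2, \<gamma>\<^sup>2 / c1\<^sup>2, 4 * sqrt 2 * \<phi> / sqrt \<gamma>, 256 * c1 ^ 4 / \<gamma> ^ 4} < ln (real n)"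
      using large n0 by (subst exp_less_cancel_iff[symmetric]) (simp only: exp_ln of_nat_0_less_iff)
    then have L2: "64 * c1\<^sup>2 / \<gamma>\<^sup>2 \<le> ln (real n)" and L3: "256 * c1 ^ 4 / \<gamma> ^ 4 \<le> ln (real n)"
      by auto
    obtain s where s: "balanced_labelling m K s" and Hs_s: "Hs = label_mat n K s"
      using balanced_clustering_matsE[OF Hs] n by blast
    have s_less: "s i < K" if "i < n" for i
      using balanced_labellingD(1)[OF s] that n by simp
    have good: "A \<in> ?G" if A: "A \<in> set_pmf ?M" and E: "A \<in> ?E" and F: "A \<in> ?F" for A
    proof (intro CollectI ballI impI allI)
      fix H0 Q H
      assume H0: "H0 \<in> clustering_mats n K" and Q: "Q \<in> permutation_mats K"
        and close: "frobenius_norm (H0 - Hs * Q) \<le> \<theta> * sqrt (real n)"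
        and out: "ppm_output m K A (iteration_bound n) H0 H"
      obtain \<pi> where \<pi>: "\<pi> permutes {..<K}"
        and Q_def: "Q = Matrix.mat K K (\<lambda>(i, j). if j = \<pi> i then 1 else 0)"
        using Q by (auto simp: permutation_mats_def)
      have HQ: "Hs * Q = label_mat n K (\<pi> \<circ> s)"
        unfolding Hs_s Q_def using s_less \<pi> by (rule label_mat_mult_permutation)
      have H0c: "H0 \<in> carrier_mat n K"
        using H0 by (auto simp: clustering_mats_def clustering_partition_def)
      have Ac: "A \<in> carrier_mat n n" using set_pmf_log_sbm[OF A] .
      have P_val: "expected_mat n ?M $$ (i, j) =
          (if (\<pi> \<circ> s) i = (\<pi> \<circ> s) j then \<alpha> else \<beta>) * ln (real n) / real n" if "i < n" "j < n" for i j
        using expected_mat_log_sbm[OF p0 p1 q0 q1 that, of Hs] permutes_inj[OF \<pi>]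
          row_label_mat_eq_iff[of i n j s, OF that s_less[OF that(1)]]
        by (simp add: Hs_s inj_eq)
      have E': "spectral_norm (A - expected_mat n ?M) \<le> c1 * sqrt (ln (real n))"
        using E by simp
      have sep': "(\<Sum>j<n. A $$ (i, j) * of_bool ((\<pi> \<circ> s) j = (\<pi> \<circ> s) i))
          - (\<Sum>j<n. A $$ (i, j) * of_bool ((\<pi> \<circ> s) j = l)) \<ge> \<gamma> * ln (real n)"
        if "i < n" "l < K" "l \<noteq> (\<pi> \<circ> s) i" for i l
        using F[unfolded Hs_s mem_Collect_eq] by (rule separation_permute[OF s \<pi> n Ac _ that])
      have "H = label_mat n K (\<pi> \<circ> s)"
        by (rule ppm_recovers[OF n n0 ab \<gamma> \<theta> L L2 L3 balanced_labelling_permute[OF s \<pi>]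
              Ac expected_mat_carrier P_val E' sep' H0c close[unfolded HQ] iteration_bound_ge out])
           (use ab in simp_all)
      then show "H = Hs * Q" by (simp only: HQ)
    qed
    have "1 - real n powr (-c') \<le> 1 - (real n powr (-3) + real n powr (-c))"
    proof -
      have n_ge1: "real n \<ge> 1" using n0 by simp
      have "real n powr (-3) \<le> real n powr (- c' - c')" "real n powr (-c) \<le> real n powr (- c' - c')"
        using c' n_ge1 by (auto intro!: powr_mono)
      moreover have "real n powr (- c' - c') = real n powr (- c') * real n powr (- c')"
        by (simp flip: powr_add)
      moreover have "real n powr (- c') * real n powr (- c') \<le> 1 / 2 * real n powr (- c')"
        using half by (intro mult_right_mono) auto
      ultimately show ?thesis by linarith
    qed
    also have "\<dots> \<le> measure_pmf.prob ?M (?E \<inter> ?F)"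
      by (rule prob_Int_ge) (use conc[of m n Hs] sep[of m n Hs] m n n_ge Hs in auto)
    also have "\<dots> \<le> measure_pmf.prob ?M ?G"
      by (rule measure_pmf.finite_measure_mono_AE) (use good in \<open>auto simp: AE_measure_pmf_iff\<close>)
    finally show "measure_pmf.prob ?M ?G \<ge> 1 - real n powr (-c')" .
  qed
qed

end
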